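(* There does not exist a finite model (i.e. a model with finite domain) that satisfies the scheme $TAS_3$.
   Context: The scheme $TAS_3$ is a set of axioms in first-order logic with equality, with unary predicates $T,N$, binary predicates $A,D,P$ and a ternary predicate $S$. All quantifiers range over the domain of a structure. $N$ is a defined predicate: $N(z)$ abbreviates $\exists x\exists y[S(z,x,y)\land D(z,x)\land D(z,y)]$. $TAS_3$ consists of the axioms: E1: $\exists x[T(x)]$. E2: $\forall x[T(x)\to\exists!\,y[A(y,x)]]$. E3: $\forall x\forall y[A(y,x)\to\exists!\,z[S(z,x,y)]]$. E4: $\exists x[N(x)]$. E5.1: $\forall x[N(x)\to\exists y[N(y)\land P(x,y)]]$. E6.1: $\forall x\exists y[P(x,y)]$. R1.1: $\forall x\forall y[A(y,x)\to[T(x)\land P(x,y)]]$. R2.1: $\forall x\forall y\forall z[S(z,x,y)\to[T(z)\land[A(x,y)\lor A(y,x)]\land S(z,y,x)\land P(x,z)\land P(y,z)]]$. R3.1: $\forall x\forall y[P(x,y)\to\neg P(y,x)]$. R4.1: $\forall x\forall y\forall z[[P(x,y)\land P(y,z)]\to P(x,z)]$. A set $X$ is finite if $X=\emptyset$ or there are a natural number $n\ge 1$ and a bijection $\{1,\dots,n\}\to X$. *)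

theory Defs
  imports Main
begin

text \<open>
  First-order structures for the signature with unary \<open>T\<close>, binary \<open>A\<close>, \<open>D\<close>, \<open>P\<close> and ternary \<open>S\<close>,
  with domain \<open>M\<close>. The symbols are interpreted by predicates on the ambient type; as all
  quantifiers range over \<open>M\<close>, only their restrictions to \<open>M\<close> matter. Domains are nonempty, as usual
  in first-order logic (this also follows from \<open>E1\<close> below).
\<close>

locale tas_structure =
  fixes M :: "'a set"
    and T :: "'a \<Rightarrow> bool"
    and A :: "'a \<Rightarrow> 'a \<Rightarrow> bool"
    and D :: "'a \<Rightarrow> 'a \<Rightarrow> bool"
    and P :: "'a \<Rightarrow> 'a \<Rightarrow> bool"
    and S :: "'a \<Rightarrow> 'a \<Rightarrow> 'a \<Rightarrow> bool"
  assumes nonempty: "M \<noteq> {}"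
begin

definition N :: "'a \<Rightarrow> bool" where
  "N z \<longleftrightarrow> (\<exists>x\<in>M. \<exists>y\<in>M. S z x y \<and> D z x \<and> D z y)"

end

locale TAS3 = tas_structure +
  assumes E1: "\<exists>x\<in>M. T x"
    and E2: "\<forall>x\<in>M. T x \<longrightarrow> (\<exists>!y\<in>M. A y x)"
    and E3: "\<forall>x\<in>M. \<forall>y\<in>M. A y x \<longrightarrow> (\<exists>!z\<in>M. S z x y)"
    and E4: "\<exists>x\<in>M. N x"
    and E5_1: "\<forall>x\<in>M. N x \<longrightarrow> (\<exists>y\<in>M. N y \<and> P x y)"
    and E6_1: "\<forall>x\<in>M. \<exists>y\<in>M. P x y"
    and R1_1: "\<forall>x\<in>M. \<forall>y\<in>M. A y x \<longrightarrow> T x \<and> P x y"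
    and R2_1: "\<forall>x\<in>M. \<forall>y\<in>M. \<forall>z\<in>M.
      S z x y \<longrightarrow> T z \<and> (A x y \<or> A y x) \<and> S z y x \<and> P x z \<and> P y z"
    and R3_1: "\<forall>x\<in>M. \<forall>y\<in>M. P x y \<longrightarrow> \<not> P y x"
    and R4_1: "\<forall>x\<in>M. \<forall>y\<in>M. \<forall>z\<in>M. P x y \<and> P y z \<longrightarrow> P x z"

end

theory Submission
  imports Defs
begin

text \<open>By \<open>R3_1\<close> and \<open>R4_1\<close>, \<open>P\<close> is a strict partial
  order on \<open>M\<close>. A nonempty finite strict order has a maximal element, whereas
  \<open>E6_1\<close> puts something strictly above every element.\<close>

theorem theorem2p8:
  "\<not> (\<exists>(M :: 'a set) T A D P S. TAS3 M T A D P S \<and> finite M)"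
proof
  assume "\<exists>(M :: 'a set) T A D P S. TAS3 M T A D P S \<and> finite M"
  then obtain M :: "'a set" and T A D P S where "TAS3 M T A D P S" and fin: "finite M"
    by blast
  then interpret TAS3 M T A D P S
    by simp
  have "asymp_on M P"
    using R3_1 by (auto intro: asymp_onI)
  moreover have "transp_on M P"
    using R4_1 by (blast intro: transp_onI)
  ultimately obtain m where m: "m \<in> M" "\<forall>x\<in>M. x \<noteq> m \<longrightarrow> \<not> P m x"
    using Finite_Set.bex_max_element[OF fin _ _ nonempty] by blast
  then show False
    \<comment> \<open>Maximality only rules out successors of \<open>m\<close> other than
      \<open>m\<close>; the remaining case \<open>P m m\<close> contradicts \<open>R3_1\<close>
      taken with both arguments equal to \<open>m\<close>.\<close>
    using E6_1 R3_1 by metis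
qed

end
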